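(* For every natural number $n$, the complete graph $K_n$ satisfies $\mathrm{pdim}(K_n) \leq \left\lceil \dfrac{\sqrt{2n+7}+1}{2} \right\rceil$.
   Context: For $q\in\mathbb{R}^d$ and $1\le i<j\le d$, let $\pi_{i,j}(q)=(q_i,q_j)$ be the projection onto the plane spanned by the $i$-th and $j$-th coordinate axes. Given a graph $G=(V,E)$, an injective map $\pi:V\to\mathbb{R}^d$ is a plane-projecting map of $G$ if there is a decomposition $E=\bigcup_{1\le i<j\le d}E_{i,j}$ such that for every $i<j$, $\pi_{i,j}\circ\pi$ is injective on $V$ and, with edges drawn as straight segments between projected endpoints, gives a straight-line planar embedding of $(V,E_{i,j})$. The plane-projecting dimension $\mathrm{pdim}(G)$ is the smallest $d$ for which a plane-projecting map of $G$ into $\mathbb{R}^d$ exists. *)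

theory Defs
  imports "HOL-Analysis.Analysis" "HOL-Library.Extended_Nat"
begin

text \<open>A graph is given by a vertex set \<open>V\<close> and a set \<open>E\<close> of two-element subsets of \<open>V\<close>.\<close>

definition complete_edges :: "'a set \<Rightarrow> 'a set set" where
  "complete_edges V = {e. e \<subseteq> V \<and> card e = 2}"

text \<open>For an edge \<open>e = {u, v}\<close> this is the closed segment from \<open>p u\<close> to \<open>p v\<close>
  (lemma \<open>drawn_edge_pair\<close>).\<close>

definition drawn_edge :: "('a \<Rightarrow> real \<times> real) \<Rightarrow> 'a set \<Rightarrow> (real \<times> real) set" where
  "drawn_edge p e = convex hull (p ` e)"

lemma drawn_edge_pair: "drawn_edge p {u, v} = closed_segment (p u) (p v)"
  by (simp add: drawn_edge_def segment_convex_hull)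

definition straight_line_embedding ::
    "'a set \<Rightarrow> 'a set set \<Rightarrow> ('a \<Rightarrow> real \<times> real) \<Rightarrow> bool" where
  "straight_line_embedding V F p \<longleftrightarrow>
     inj_on p V \<and>
     (\<forall>e\<in>F. \<forall>w\<in>V. p w \<in> drawn_edge p e \<longrightarrow> w \<in> e) \<and>
     (\<forall>e\<in>F. \<forall>f\<in>F. e \<noteq> f \<longrightarrow> drawn_edge p e \<inter> drawn_edge p f = p ` (e \<inter> f))"

text \<open>The dimension is a natural number that varies inside the statements below, so \<open>\<real>\<^sup>d\<close> is
  the set of extensional functions \<open>{1..d} \<rightarrow> \<real>\<close>.\<close>

definition euclid :: "nat \<Rightarrow> (nat \<Rightarrow> real) set" where
  "euclid d = {1..d} \<rightarrow>\<^sub>E UNIV"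

definition plane_proj :: "nat \<Rightarrow> nat \<Rightarrow> (nat \<Rightarrow> real) \<Rightarrow> real \<times> real" where
  "plane_proj i j q = (q i, q j)"

definition coord_pairs :: "nat \<Rightarrow> (nat \<times> nat) set" where
  "coord_pairs d = {(i, j). 1 \<le> i \<and> i < j \<and> j \<le> d}"

definition plane_projecting_map ::
    "nat \<Rightarrow> 'a set \<Rightarrow> 'a set set \<Rightarrow> ('a \<Rightarrow> nat \<Rightarrow> real) \<Rightarrow> bool" where
  "plane_projecting_map d V E \<pi> \<longleftrightarrow>
     \<pi> \<in> V \<rightarrow> euclid d \<and> inj_on \<pi> V \<and>
     (\<exists>D :: nat \<times> nat \<Rightarrow> 'a set set.
        E = (\<Union>ij\<in>coord_pairs d. D ij) \<and>
        disjoint_family_on D (coord_pairs d) \<and>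
        (\<forall>(i, j)\<in>coord_pairs d. straight_line_embedding V (D (i, j)) (plane_proj i j \<circ> \<pi>)))"

text \<open>The infimum is taken in \<^typ>\<open>enat\<close>, so that it is \<open>\<infinity>\<close> if there is no plane-projecting map at
  all; in particular a finite upper bound entails existence (lemma \<open>pdim_le_enat_iff\<close>).\<close>

definition pdim :: "'a set \<Rightarrow> 'a set set \<Rightarrow> enat" where
  "pdim V E = (INF d\<in>{d. \<exists>\<pi>. plane_projecting_map d V E \<pi>}. enat d)"

lemma pdim_le_enat_iff:
  "pdim V E \<le> enat k \<longleftrightarrow> (\<exists>d\<le>k. \<exists>\<pi>. plane_projecting_map d V E \<pi>)"
proof
  let ?S = "{d. \<exists>\<pi>. plane_projecting_map d V E \<pi>}"
  assume "pdim V E \<le> enat k"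
  then have le: "Inf (enat ` ?S) \<le> enat k"
    by (simp add: pdim_def)
  then have "enat ` ?S \<noteq> {}"
    by (metis Inf_empty enat_ord_code(5) top_enat_def)
  then have "Inf (enat ` ?S) \<in> enat ` ?S"
    by (meson ex_in_conv wellorder_InfI)
  with le show "\<exists>d\<le>k. \<exists>\<pi>. plane_projecting_map d V E \<pi>"
    by auto
next
  assume "\<exists>d\<le>k. \<exists>\<pi>. plane_projecting_map d V E \<pi>"
  then show "pdim V E \<le> enat k"
    unfolding pdim_def by (metis (mono_tags, lifting) INF_lower2 enat_ord_simps(1) mem_Collect_eq)
qed

end

theory Submission
  imports Defs
begin

text \<open>
  Placing the \<open>i\<close>-th coordinate of a planar point \<open>(x, y)\<close> at \<open>x + i y\<close> makes every coordinate
  projection a linear image of one planar point set. So it suffices to draw \<open>K\<^sub>4\<^sub>m\<close>, for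
  \<open>m = d (d - 1) / 2\<close>, on one planar point set in \<open>m\<close> plane layers; this is the bound \<open>\<lceil>n / 4\<rceil>\<close> of
  Dillencourt, Eppstein and Hirschberg on the geometric thickness of \<open>K\<^sub>n\<close>.

  The points form an outer ring of \<open>2 m\<close> points and a tiny concentric inner ring of \<open>2 m\<close> points.
  Each ring decomposes into \<open>m\<close> zigzag Hamiltonian paths. Layer \<open>j\<close> consists of a zigzag of each ring
  and of all edges between the inner ring and two nearly antipodal outer points \<open>j\<close> and \<open>j + m\<close>.
  Seen from these two points the inner ring is so small that the connecting edges are almost
  parallel, and the inner zigzag is monotone across their direction. The outer zigzag contains
  the edge between \<open>j\<close> and \<open>j + m\<close>, hence none of its edges separates them from the centre.
\<close>

section \<open>Orientations and plane straight-line drawings\<close>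

definition crs :: "real \<times> real \<Rightarrow> real \<times> real \<Rightarrow> real" where
  "crs p q = fst p * snd q - snd p * fst q"

definition orient :: "real \<times> real \<Rightarrow> real \<times> real \<Rightarrow> real \<times> real \<Rightarrow> real" where
  "orient p q s = crs (q - p) (s - p)"

lemma orient_swap12: "orient q p s = - orient p q s"
  and orient_swap23: "orient p s q = - orient p q s"
  and orient_rotate: "orient q s p = orient p q s"
  by (simp_all add: orient_def crs_def algebra_simps)

lemma orient_repeat [simp]: "orient p p s = 0" "orient p s p = 0" "orient s p p = 0"
  by (simp_all add: orient_def crs_def algebra_simps)

lemma orient_affine_comb:
  "orient p q ((1 - t) *\<^sub>R a + t *\<^sub>R b) = (1 - t) * orient p q a + t * orient p q b"
  by (simp add: orient_def crs_def algebra_simps)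

lemma orient_eq_0_if_on_segment:
  assumes "z \<in> closed_segment p q" shows "orient p q z = 0"
  using assms by (auto simp: in_segment orient_affine_comb)

text \<open>\<open>orient a b\<close> is affine along \<open>c d\<close> and keeps one strict sign
  at both ends, so it has no zero there; on \<open>a b\<close> it vanishes.\<close>

lemma disjoint_segments_if_same_side:
  assumes "orient a b c * orient a b d > 0"
  shows "closed_segment a b \<inter> closed_segment c d = {}"
proof (rule ccontr)
  assume "\<not> ?thesis"
  then obtain z where z: "z \<in> closed_segment a b" "z \<in> closed_segment c d" by auto
  then obtain t where t: "0 \<le> t" "t \<le> 1" "z = (1 - t) *\<^sub>R c + t *\<^sub>R d" by (auto simp: in_segment)
  have eq: "(1 - t) * orient a b c + t * orient a b d = 0"
    using orient_eq_0_if_on_segment[OF z(1)] t(3) orient_affine_comb by simp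
  have "orient a b c * ((1 - t) * orient a b c + t * orient a b d)
      = (1 - t) * (orient a b c)\<^sup>2 + t * (orient a b c * orient a b d)"
    by (simp add: power2_eq_square algebra_simps)
  also have "\<dots> > 0"
  proof (cases "t = 0")
    case True then show ?thesis using assms by (auto simp: zero_less_mult_iff)
  next
    case False
    then have "t * (orient a b c * orient a b d) > 0" using t assms by simp
    moreover have "(1 - t) * (orient a b c)\<^sup>2 \<ge> 0" using t by simp
    ultimately show ?thesis by linarith
  qed
  finally show False using eq by simp
qed

lemma segments_meet_at_common_endpoint:
  assumes "orient a b c \<noteq> 0"
  shows "closed_segment a b \<inter> closed_segment a c = {a}"
proof -
  have "z = a" if z: "z \<in> closed_segment a b" "z \<in> closed_segment a c" for z
  proof -
    from z(2) obtain t where t: "z = (1 - t) *\<^sub>R a + t *\<^sub>R c" by (auto simp: in_segment)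
    then have "t * orient a b c = 0"
      using orient_eq_0_if_on_segment[OF z(1)] orient_affine_comb[of a b t a c] by simp
    then show ?thesis using assms t by simp
  qed
  then show ?thesis by auto
qed

text \<open>A certificate of disjointness that uses signs of orientations only, and so survives
  invertible linear maps and small perturbations.\<close>

definition separated :: "('a \<Rightarrow> real \<times> real) \<Rightarrow> 'a \<Rightarrow> 'a \<Rightarrow> 'a \<Rightarrow> 'a \<Rightarrow> bool" where
  "separated p a b c d \<longleftrightarrow>
     orient (p a) (p b) (p c) * orient (p a) (p b) (p d) > 0 \<or>
     orient (p c) (p d) (p a) * orient (p c) (p d) (p b) > 0"

lemma separated_swap_edges: "separated p c d a b \<longleftrightarrow> separated p a b c d"
  by (auto simp: separated_def)

lemma separated_swap_left: "separated p b a c d \<longleftrightarrow> separated p a b c d"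
  by (simp add: separated_def orient_swap12[of "p b" "p a"] mult.commute)

lemma separated_swap_right: "separated p a b d c \<longleftrightarrow> separated p a b c d"
  using separated_swap_edges separated_swap_left by metis

definition general_position :: "'a set \<Rightarrow> ('a \<Rightarrow> real \<times> real) \<Rightarrow> bool" where
  "general_position V p \<longleftrightarrow>
     (\<forall>a\<in>V. \<forall>b\<in>V. \<forall>c\<in>V. a \<noteq> b \<longrightarrow> b \<noteq> c \<longrightarrow> a \<noteq> c \<longrightarrow> orient (p a) (p b) (p c) \<noteq> 0)"

text \<open>General position deals with vertices on edges and with edges that share an end; only
  vertex-disjoint pairs need a check.\<close>

lemma straight_line_embeddingI:
  assumes inj: "inj_on p V" and F: "F \<subseteq> complete_edges V" and gp: "general_position V p"
    and sep: "\<And>a b c d. \<lbrakk>{a, b} \<in> F; {c, d} \<in> F; distinct [a, b, c, d]\<rbrakk> \<Longrightarrow> separated p a b c d"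
  shows "straight_line_embedding V F p"
  unfolding straight_line_embedding_def
proof (intro conjI ballI impI)
  show "inj_on p V" by fact
next
  fix e w assume e: "e \<in> F" and w: "w \<in> V" "p w \<in> drawn_edge p e"
  obtain a b where ab: "e = {a, b}" "a \<noteq> b" "a \<in> V" "b \<in> V"
    using e F by (auto simp: complete_edges_def card_2_iff)
  then have "orient (p a) (p b) (p w) = 0"
    using w orient_eq_0_if_on_segment by (simp add: drawn_edge_pair)
  then show "w \<in> e" using gp ab w by (auto simp: general_position_def)
next
  fix e f assume e: "e \<in> F" and f: "f \<in> F" and "e \<noteq> f"
  obtain a b where ab: "e = {a, b}" "a \<noteq> b" "a \<in> V" "b \<in> V"
    using e F by (auto simp: complete_edges_def card_2_iff)
  obtain c d where cd: "f = {c, d}" "c \<noteq> d" "c \<in> V" "d \<in> V"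
    using f F by (auto simp: complete_edges_def card_2_iff)
  show "drawn_edge p e \<inter> drawn_edge p f = p ` (e \<inter> f)"
  proof (cases "e \<inter> f = {}")
    case True
    then have "separated p a b c d" using ab cd e f by (intro sep) auto
    then have "closed_segment (p a) (p b) \<inter> closed_segment (p c) (p d) = {}"
      unfolding separated_def using disjoint_segments_if_same_side by blast
    then show ?thesis using True ab cd by (simp add: drawn_edge_pair)
  next
    case False
    then obtain x where "x \<in> e" "x \<in> f" by auto
    then obtain y z where yz: "e = {x, y}" "f = {x, z}" "y \<in> V" "z \<in> V" "x \<in> V" "x \<noteq> y" "x \<noteq> z"
      using ab cd by auto
    with \<open>e \<noteq> f\<close> have "y \<noteq> z" by auto
    with yz have "orient (p x) (p y) (p z) \<noteq> 0" using gp by (auto simp: general_position_def)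
    then have "closed_segment (p x) (p y) \<inter> closed_segment (p x) (p z) = {p x}"
      by (rule segments_meet_at_common_endpoint)
    moreover have "e \<inter> f = {x}" using yz \<open>y \<noteq> z\<close> by auto
    ultimately show ?thesis unfolding \<open>e \<inter> f = {x}\<close> using yz by (simp add: drawn_edge_pair)
  qed
qed

section \<open>Coordinate projections as linear images of the plane\<close>

definition sheared :: "real \<Rightarrow> real \<Rightarrow> real \<times> real \<Rightarrow> real \<times> real" where
  "sheared s t p = (fst p + s * snd p, fst p + t * snd p)"

lemma orient_sheared: "orient (sheared s t a) (sheared s t b) (sheared s t c) = (t - s) * orient a b c"
  by (simp add: sheared_def orient_def crs_def algebra_simps)

lemma inj_sheared: "s \<noteq> t \<Longrightarrow> inj (sheared s t)"
proof (rule injI)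
  fix a b assume st: "s \<noteq> t" and eq: "sheared s t a = sheared s t b"
  then have 1: "fst a + s * snd a = fst b + s * snd b" and 2: "fst a + t * snd a = fst b + t * snd b"
    by (auto simp: sheared_def)
  then have "(s - t) * (snd a - snd b) = 0" by (simp add: algebra_simps)
  then have "snd a = snd b" using st by simp
  with 1 show "a = b" by (simp add: prod_eq_iff)
qed

lemma general_position_sheared:
  "s \<noteq> t \<Longrightarrow> general_position V p \<Longrightarrow> general_position V (sheared s t \<circ> p)"
  by (simp add: general_position_def orient_sheared)

text \<open>The factor \<open>t - s\<close>, the determinant of the map, enters both orientations
  and leaves a positive square.\<close>

lemma separated_sheared:
  assumes "s \<noteq> t" shows "separated (sheared s t \<circ> p) a b c d \<longleftrightarrow> separated p a b c d"
proof -
  have "((t - s) * x) * ((t - s) * y) > 0 \<longleftrightarrow> x * y > 0" for x y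
  proof -
    have "((t - s) * x) * ((t - s) * y) = (t - s)\<^sup>2 * (x * y)" by (simp add: power2_eq_square)
    moreover have "(t - s)\<^sup>2 > 0" using assms by simp
    ultimately show ?thesis by (metis zero_less_mult_pos mult_pos_pos)
  qed
  then show ?thesis by (simp add: separated_def orient_sheared)
qed

lemma finite_coord_pairs: "finite (coord_pairs d)"
  by (rule finite_subset[of _ "{..d} \<times> {..d}"]) (auto simp: coord_pairs_def)

lemma card_coord_pairs: "2 * card (coord_pairs d) = d * (d - 1)"
proof (induction d)
  case 0
  have "coord_pairs 0 = {}" by (auto simp: coord_pairs_def)
  then show ?case by simp
next
  case (Suc d)
  have eq: "coord_pairs (Suc d) = coord_pairs d \<union> (\<lambda>i. (i, Suc d)) ` {1..d}"
    by (auto simp: coord_pairs_def)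
  have "card (coord_pairs (Suc d)) = card (coord_pairs d) + card ((\<lambda>i. (i, Suc d)) ` {1..d})"
    unfolding eq by (rule card_Un_disjoint) (auto simp: finite_coord_pairs, auto simp: coord_pairs_def)
  also have "card ((\<lambda>i. (i, Suc d)) ` {1..d}) = d" by (subst card_image) (auto simp: inj_on_def)
  finally show ?case using Suc by (cases d) (auto simp: algebra_simps)
qed

text \<open>If \<open>q\<^sub>i = x + i y\<close> for a planar point \<open>(x, y)\<close>, then every coordinate projection is a linear
  isomorphic image of the plane. Hence a decomposition over a single planar point set into as many
  plane layers as there are coordinate pairs is enough.\<close>

lemma plane_projecting_map_if_layers:
  fixes p :: "'a \<Rightarrow> real \<times> real" and F :: "nat \<Rightarrow> 'a set set"
  assumes d: "d \<ge> 2" and inj: "inj_on p V" and gp: "general_position V p"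
    and E: "E = (\<Union>l<card (coord_pairs d). F l)" "E \<subseteq> complete_edges V"
    and sep: "\<And>l a b c d'. \<lbrakk>l < card (coord_pairs d); {a, b} \<in> F l; {c, d'} \<in> F l;
                 distinct [a, b, c, d']\<rbrakk> \<Longrightarrow> separated p a b c d'"
  shows "\<exists>\<pi>. plane_projecting_map d V E \<pi>"
proof -
  define \<pi> where "\<pi> v = (\<lambda>i\<in>{1..d}. fst (p v) + real i * snd (p v))" for v
  obtain f where f: "bij_betw f (coord_pairs d) {..<card (coord_pairs d)}"
    using ex_bij_betw_finite_nat[OF finite_coord_pairs, of d] by (auto simp: atLeast0LessThan)
  \<comment> \<open>Layers may overlap while the decomposition must be disjoint; a subset of a layer
    stays separated.\<close>
  define D where "D ij = disjointed F (f ij)" for ij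
  have proj: "(plane_proj i j \<circ> \<pi>) v = sheared (real i) (real j) (p v)" if "(i, j) \<in> coord_pairs d" for i j v
    using that by (auto simp: plane_proj_def \<pi>_def sheared_def coord_pairs_def)
  have "inj_on \<pi> V"
  proof (rule inj_onI)
    fix u v assume uv: "u \<in> V" "v \<in> V" "\<pi> u = \<pi> v"
    \<comment> \<open>One injective projection is enough, and \<open>d \<ge> 2\<close> provides
      it.\<close>
    have "(1, 2) \<in> coord_pairs d" using d by (auto simp: coord_pairs_def)
    from proj[OF this] uv(3) have "sheared 1 2 (p u) = sheared 1 2 (p v)" by (metis comp_apply of_nat_1 of_nat_numeral)
    then have "p u = p v" using inj_sheared[of 1 2] by (simp add: inj_eq)
    then show "u = v" using uv inj by (auto dest: inj_onD)
  qed
  moreover have "\<pi> \<in> V \<rightarrow> euclid d" by (auto simp: \<pi>_def euclid_def)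
  moreover have "E = (\<Union>ij\<in>coord_pairs d. D ij)"
  proof -
    have "(\<Union>ij\<in>coord_pairs d. D ij) = (\<Union>l\<in>f ` coord_pairs d. disjointed F l)" by (simp add: D_def)
    also have "f ` coord_pairs d = {0..<card (coord_pairs d)}"
      using f by (auto simp: bij_betw_def)
    finally show ?thesis using E(1) by (simp add: finite_UN_disjointed_eq flip: atLeast0LessThan)
  qed
  moreover have "disjoint_family_on D (coord_pairs d)"
    unfolding disjoint_family_on_def
  proof (intro ballI impI)
    fix x y assume "x \<in> coord_pairs d" "y \<in> coord_pairs d" "x \<noteq> y"
    then have "f x \<noteq> f y" using f by (auto simp: bij_betw_def dest: inj_onD)
    then show "D x \<inter> D y = {}"
      using disjoint_family_disjointed[of F] by (auto simp: D_def disjoint_family_on_def)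
  qed
  moreover have "straight_line_embedding V (D (i, j)) (plane_proj i j \<circ> \<pi>)" if ij: "(i, j) \<in> coord_pairs d" for i j
  proof -
    have ne: "real i \<noteq> real j" using ij by (auto simp: coord_pairs_def)
    have fl: "f (i, j) < card (coord_pairs d)" using f ij by (auto simp: bij_betw_def)
    have sub: "D (i, j) \<subseteq> F (f (i, j))" by (simp add: D_def disjointed_subset)
    have "plane_proj i j \<circ> \<pi> = sheared (real i) (real j) \<circ> p" using proj[OF ij] by (simp add: fun_eq_iff)
    moreover have "straight_line_embedding V (D (i, j)) (sheared (real i) (real j) \<circ> p)"
    proof (rule straight_line_embeddingI)
      show "inj_on (sheared (real i) (real j) \<circ> p) V"
        using inj inj_sheared[OF ne] by (meson comp_inj_on inj_on_subset top_greatest)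
      show "D (i, j) \<subseteq> complete_edges V" using sub fl E by blast
      show "general_position V (sheared (real i) (real j) \<circ> p)"
        using gp ne by (rule general_position_sheared[rotated])
      fix a b c d' assume "{a, b} \<in> D (i, j)" "{c, d'} \<in> D (i, j)" and dist: "distinct [a, b, c, d']"
      then have "{a, b} \<in> F (f (i, j))" "{c, d'} \<in> F (f (i, j))" using sub by auto
      then have "separated p a b c d'" using dist by (rule sep[OF fl])
      then show "separated (sheared (real i) (real j) \<circ> p) a b c d'" by (simp only: separated_sheared[OF ne])
    qed
    ultimately show ?thesis by simp
  qed
  ultimately have "plane_projecting_map d V E \<pi>"
    unfolding plane_projecting_map_def by blast
  then show ?thesis by blast
qed

text \<open>Lets orientations be replaced by the signs of their leading terms as the inner ring
  shrinks.\<close>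

lemma mult_pos_cong_sgn:
  fixes x y x' y' :: real
  assumes "sgn x = sgn x'" "sgn y = sgn y'"
  shows "x * y > 0 \<longleftrightarrow> x' * y' > 0"
  using assms by (metis sgn_mult sgn_greater)

section \<open>Orientations on the unit circle\<close>

definition on_circle :: "real \<Rightarrow> real \<times> real" where
  "on_circle t = (cos t, sin t)"

lemma crs_on_circle: "crs (on_circle s) (on_circle t) = sin (t - s)"
  by (simp add: crs_def on_circle_def sin_diff algebra_simps)

text \<open>With half differences \<open>u\<close> and \<open>v\<close> this is
  \<open>sin 2u + sin 2v - sin (2u + 2v) = 4 sin u sin v sin (u + v)\<close>.\<close>

lemma orient_on_circle:
  "orient (on_circle x) (on_circle y) (on_circle z) = 4 * sin ((y - x) / 2) * sin ((z - y) / 2) * sin ((z - x) / 2)"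
proof -
  define u v where "u = (y - x) / 2" and "v = (z - y) / 2"
  have yz: "y = x + 2 * u" "z = x + 2 * u + 2 * v" by (simp_all add: u_def v_def field_simps)
  have "orient (on_circle x) (on_circle y) (on_circle z)
      = crs (on_circle x) (on_circle y) + crs (on_circle y) (on_circle z) - crs (on_circle x) (on_circle z)"
    by (simp add: orient_def crs_def algebra_simps)
  also have "\<dots> = sin (2 * u) + sin (2 * v) - sin (2 * u + 2 * v)"
    by (simp add: crs_on_circle yz algebra_simps)
  also have "\<dots> = sin (2 * u) * (1 - cos (2 * v)) + sin (2 * v) * (1 - cos (2 * u))"
    by (simp add: sin_add algebra_simps)
  also have "\<dots> = 4 * sin u * sin v * (sin u * cos v + cos u * sin v)"
    unfolding sin_double cos_double_sin by (simp add: power2_eq_square algebra_simps)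
  also have "\<dots> = 4 * sin u * sin v * sin (u + v)" by (simp add: sin_add)
  finally show ?thesis by (simp add: u_def v_def flip: add_divide_distrib)
qed

lemma sgn_sin_half:
  assumes "\<bar>t\<bar> < 2 * pi" shows "sgn (sin (t / 2)) = sgn t"
proof (cases t "0 :: real" rule: linorder_cases)
  case less
  then have "sin (- t / 2) > 0" using assms by (intro sin_gt_zero) auto
  then show ?thesis using less by simp
next
  case greater
  then have "sin (t / 2) > 0" using assms by (intro sin_gt_zero) auto
  then show ?thesis using greater by simp
qed simp

lemma sgn_orient_on_circle:
  assumes "\<bar>y - x\<bar> < 2 * pi" "\<bar>z - y\<bar> < 2 * pi" "\<bar>z - x\<bar> < 2 * pi"
  shows "sgn (orient (on_circle x) (on_circle y) (on_circle z)) = sgn (y - x) * sgn (z - y) * sgn (z - x)"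
  using assms by (simp add: orient_on_circle sgn_mult sgn_sin_half)

section \<open>Zigzags in convex position\<close>

definition interleaved :: "nat \<Rightarrow> nat \<Rightarrow> nat \<Rightarrow> nat \<Rightarrow> bool" where
  "interleaved a b c d \<longleftrightarrow> a < c \<and> c < b \<and> b < d \<or> c < a \<and> a < d \<and> d < b"

text \<open>In a regular \<open>N\<close>-gon, chords with equal index sum modulo \<open>N\<close>
  are parallel; two consecutive parallel classes form a zigzag.\<close>

definition zigzag :: "nat \<Rightarrow> int \<Rightarrow> nat \<Rightarrow> nat \<Rightarrow> bool" where
  "zigzag N s a b \<longleftrightarrow> (int a + int b - s) mod int N \<in> {0, 1}"

lemma zigzag_sym: "zigzag N s a b \<longleftrightarrow> zigzag N s b a"
  by (simp add: zigzag_def add.commute)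

text \<open>Crossing chords have index sums that differ by at least \<open>2\<close> and at most \<open>N - 2\<close>.\<close>

lemma zigzag_not_interleaved_aux:
  assumes "zigzag N s a b" "zigzag N s c d" "d < N" "a < c" "c < b" "b < d"
  shows False
proof -
  obtain q e where q: "int a + int b - s = int N * q + e" "e \<in> {0, 1}"
    using assms(1) unfolding zigzag_def by (metis mult_div_mod_eq)
  obtain q' e' where q': "int c + int d - s = int N * q' + e'" "e' \<in> {0, 1}"
    using assms(2) unfolding zigzag_def by (metis mult_div_mod_eq)
  have diff: "(int c + int d) - (int a + int b) = int N * (q' - q) + (e' - e)"
    using q q' by (simp add: algebra_simps)
  have "int N * (q' - q) \<le> 0 \<or> int N * (q' - q) \<ge> int N"
  proof (cases "q' \<le> q")
    case True then show ?thesis by (simp add: mult_nonneg_nonpos)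
  next
    case False
    then have "int N * 1 \<le> int N * (q' - q)" by (intro mult_left_mono) auto
    then show ?thesis by simp
  qed
  moreover have "\<bar>e' - e\<bar> \<le> 1" using q(2) q'(2) by auto
  ultimately show False using diff assms(3-) by linarith
qed

lemma zigzag_not_interleaved:
  assumes "zigzag N s a b" "zigzag N s c d" "b < N" "d < N"
  shows "\<not> interleaved a b c d"
  using zigzag_not_interleaved_aux assms unfolding interleaved_def by blast

text \<open>For ascending \<open>a\<close>, \<open>b\<close> the orientation is negative exactly
  when the third index lies between them; without interleaving, \<open>c\<close> and
  \<open>d\<close> are on the same arc.\<close>

lemma orient_on_circle_pos_if_not_interleaved:
  fixes f :: "nat \<Rightarrow> real"
  assumes f: "\<And>i j. i < j \<Longrightarrow> j < N \<Longrightarrow> f i < f j \<and> f j - f i < 2 * pi"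
    and ord: "a < b" "c < d" "b < N" "d < N" and dist: "distinct [a, b, c, d]"
    and "\<not> interleaved a b c d"
  shows "orient (on_circle (f a)) (on_circle (f b)) (on_circle (f c))
       * orient (on_circle (f a)) (on_circle (f b)) (on_circle (f d)) > 0"
proof -
  have bnd: "\<bar>f j - f i\<bar> < 2 * pi" if "i < N" "j < N" for i j
    using f[of i j] f[of j i] that by (cases i j rule: linorder_cases) auto
  have sg: "sgn (f j - f i) = (if i < j then 1 else -1)" if "i < N" "j < N" "i \<noteq> j" for i j
    using f[of i j] f[of j i] that by (cases i j rule: linorder_cases) auto
  have "sgn (orient (on_circle (f a)) (on_circle (f b)) (on_circle (f c))
       * orient (on_circle (f a)) (on_circle (f b)) (on_circle (f d))) = 1"
    unfolding sgn_mult using assms(2-) by (auto simp: sgn_orient_on_circle bnd sg interleaved_def)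
  then show ?thesis by (simp add: sgn_1_pos)
qed

section \<open>The two rings\<close>

lemma sin_int_times_pi: "sin (of_int q * pi) = 0"
  by (auto simp: sin_zero_iff_int2)

lemma cos_int_times_pi_squared: "cos (of_int q * pi) * cos (of_int q * pi) = 1"
  using sin_cos_squared_add[of "of_int q * pi"] by (simp add: sin_int_times_pi power2_eq_square)

text \<open>The angles in use are integers in the unit \<open>pi / (6 m)\<close>, \<open>6 m\<close>
  of which make a half turn, so integer division settles signs.\<close>

definition sin_unit :: "nat \<Rightarrow> int \<Rightarrow> real" where
  "sin_unit m t = sin (of_int t * (pi / (6 * real m)))"

lemma sin_unit_pos:
  assumes "0 < t" "t < 6 * int m" shows "sin_unit m t > 0"
proof -
  have "real_of_int t < 6 * real m" using assms(2) by linarith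
  then have "of_int t * (pi / (6 * real m)) < pi" using assms by (simp add: field_simps)
  moreover have "of_int t * (pi / (6 * real m)) > 0" using assms by simp
  ultimately show ?thesis unfolding sin_unit_def by (intro sin_gt_zero)
qed

text \<open>\<open>cos (of_int q * pi)\<close> serves as \<open>(-1) ^ q\<close> for integers
  \<open>q\<close> of either sign.\<close>

lemma sin_unit_shift:
  assumes "m > 0" shows "sin_unit m (6 * int m * q + t) = cos (of_int q * pi) * sin_unit m t"
proof -
  have "of_int (6 * int m * q + t) * (pi / (6 * real m)) = of_int q * pi + of_int t * (pi / (6 * real m))"
    using assms by (simp add: field_simps)
  then show ?thesis by (simp add: sin_unit_def sin_add sin_int_times_pi)
qed

lemma sin_unit_shift1: "m > 0 \<Longrightarrow> sin_unit m (6 * int m + t) = - sin_unit m t"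
  using sin_unit_shift[of m 1 t] by simp

lemma sin_unit_mult_pos:
  assumes "m > 0" "0 < r" "r < 6 * int m" "0 < r'" "r' < 6 * int m"
  shows "sin_unit m (6 * int m * q + r) * sin_unit m (6 * int m * q + r') > 0"
proof -
  have "sin_unit m (6 * int m * q + r) * sin_unit m (6 * int m * q + r')
      = (cos (of_int q * pi) * cos (of_int q * pi)) * (sin_unit m r * sin_unit m r')"
    using assms(1) by (simp add: sin_unit_shift)
  then have "sin_unit m (6 * int m * q + r) * sin_unit m (6 * int m * q + r') = sin_unit m r * sin_unit m r'"
    by (simp only: cos_int_times_pi_squared mult_1)
  then show ?thesis using assms by (simp add: sin_unit_pos)
qed

text \<open>Zeros occur at the multiples of \<open>6 m\<close> only. So \<open>3 c\<close> is at
  least three units from each, and a shorter shift crosses none.\<close>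

lemma sin_unit_perturb:
  assumes m: "m > 0" and c: "\<not> 2 * int m dvd c" and t: "\<bar>t\<bar> < 3"
  shows "sin_unit m (3 * c) * sin_unit m (3 * c + t) > 0"
proof -
  define q r where "q = c div (2 * int m)" and "r = c mod (2 * int m)"
  have c': "c = 2 * int m * q + r" by (simp add: q_def r_def)
  have r: "0 < r" "r < 2 * int m" using m c by (auto simp: r_def dvd_eq_mod_eq_0 order.not_eq_order_implies_strict)
  show ?thesis using sin_unit_mult_pos[OF m, of "3 * r" "3 * r + t" q] r t
    by (simp add: c' algebra_simps)
qed

text \<open>Zeros are multiples of three, and both arguments lie strictly between
  \<open>3 (c - 1)\<close> and \<open>3 c\<close>.\<close>

lemma sin_unit_between:
  assumes m: "m > 0"
  shows "sin_unit m (3 * c - 1) * sin_unit m (3 * c - 2) > 0"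
proof -
  define q r where "q = (c - 1) div (2 * int m)" and "r = (c - 1) mod (2 * int m)"
  have "c - 1 = 2 * int m * q + r" by (simp add: q_def r_def)
  then have c': "c = 2 * int m * q + r + 1" by simp
  have r: "0 \<le> r" "r < 2 * int m" using m by (auto simp: r_def)
  show ?thesis using sin_unit_mult_pos[OF m, of "3 * r + 2" "3 * r + 1" q] r
    by (simp add: c' algebra_simps)
qed

text \<open>
  In the unit \<open>\<pi> / (6 m)\<close>, the chord of the inner ring through \<open>a\<close> and \<open>b\<close> has direction \<open>3 (a + b)\<close>.
  The directions \<open>6 j + 1\<close> of the outer point \<open>j\<close> and \<open>6 j + 2\<close> opposite to the outer point \<open>j + m\<close> lie
  strictly between the directions \<open>6 j\<close> and \<open>6 j + 3\<close> of the edges of the \<open>j\<close>-th inner zigzag. They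
  differ, so that no chord of the outer ring passes through the centre.
\<close>

definition outer_angle :: "nat \<Rightarrow> nat \<Rightarrow> int" where
  "outer_angle m k = 6 * int k + (if k < m then 1 else 2)"

definition outer :: "nat \<Rightarrow> nat \<Rightarrow> real \<times> real" where
  "outer m k = on_circle (of_int (outer_angle m k) * (pi / (6 * real m)))"

text \<open>The quarter turn makes \<open>3 (a + b)\<close> units the direction of the chord from
  \<open>a\<close> to \<open>b\<close>, not of its normal.\<close>

definition inner :: "nat \<Rightarrow> nat \<Rightarrow> real \<times> real" where
  "inner m a = on_circle (6 * real a * (pi / (6 * real m)) - pi / 2)"

lemma crs_outer_outer: "crs (outer m k) (outer m l) = sin_unit m (outer_angle m l - outer_angle m k)"
  by (simp add: outer_def crs_on_circle sin_unit_def left_diff_distrib diff_divide_distrib)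

text \<open>The pair with \<open>l - k = m\<close> spans \<open>6 m + 1\<close> units, just over a
  half turn, hence belongs to the negative case.\<close>

lemma sgn_crs_outer_outer:
  assumes "k < l" "l < 2 * m"
  shows "sgn (crs (outer m k) (outer m l)) = (if l - k < m then 1 else -1)"
proof (cases "l - k < m")
  case True
  then have "sin_unit m (outer_angle m l - outer_angle m k) > 0"
    using assms by (intro sin_unit_pos) (auto simp: outer_angle_def)
  then show ?thesis using True by (simp add: crs_outer_outer)
next
  case False
  define t where "t = outer_angle m l - outer_angle m k - 6 * int m"
  have "sin_unit m t > 0"
    using assms False by (intro sin_unit_pos) (auto simp: t_def outer_angle_def)
  moreover have "outer_angle m l - outer_angle m k = 6 * int m + t" by (simp add: t_def)
  ultimately show ?thesis using False assms by (simp add: crs_outer_outer sin_unit_shift1)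
qed

text \<open>By sum-to-product: the signed chord length times the sine of the angle between the line
  of sight and the chord.\<close>

lemma crs_outer_inner_diff:
  "crs (outer m k) (inner m a - inner m b)
     = 2 * sin_unit m (3 * (int a - int b)) * sin_unit m (3 * (int a + int b) - outer_angle m k)"
proof -
  define h where "h = pi / (6 * real m)"
  define \<tau> where "\<tau> = of_int (outer_angle m k) * h"
  have "crs (outer m k) (inner m a - inner m b) = crs (outer m k) (inner m a) - crs (outer m k) (inner m b)"
    by (simp add: crs_def algebra_simps)
  also have "\<dots> = sin (6 * real a * h - \<tau> - pi / 2) - sin (6 * real b * h - \<tau> - pi / 2)"
    by (simp add: outer_def inner_def crs_on_circle h_def \<tau>_def algebra_simps)
  also have "\<dots> = cos (6 * real b * h - \<tau>) - cos (6 * real a * h - \<tau>)"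
    by (simp add: sin_diff)
  also have "\<dots> = 2 * sin ((6 * real b * h - \<tau> + (6 * real a * h - \<tau>)) / 2)
                   * sin (((6 * real a * h - \<tau>) - (6 * real b * h - \<tau>)) / 2)"
    by (rule cos_diff_cos)
  also have "(6 * real b * h - \<tau> + (6 * real a * h - \<tau>)) / 2 = of_int (3 * (int a + int b) - outer_angle m k) * h"
    by (simp add: \<tau>_def field_simps)
  also have "((6 * real a * h - \<tau>) - (6 * real b * h - \<tau>)) / 2 = of_int (3 * (int a - int b)) * h"
    by (simp add: field_simps)
  finally show ?thesis by (simp add: sin_unit_def h_def)
qed

lemma not_dvd_diff:
  assumes "a < N" "b < N" "a \<noteq> b" shows "\<not> int N dvd int a - int b"
  using assms zdvd_not_zless by (auto simp flip: mod_eq_dvd_iff)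

text \<open>\<open>3 (a - b)\<close> is no multiple of \<open>6 m\<close>, and the other argument is
  not even a multiple of three.\<close>

lemma crs_outer_inner_diff_nonzero:
  assumes "m > 0" "k < 2 * m" "a < 2 * m" "b < 2 * m" "a \<noteq> b"
  shows "crs (outer m k) (inner m a - inner m b) \<noteq> 0"
proof -
  have "sin_unit m (3 * (int a - int b)) \<noteq> 0"
    using sin_unit_perturb[OF assms(1), of "int a - int b" 0] not_dvd_diff[of a "2 * m" b] assms by auto
  moreover have "sin_unit m (3 * (int a + int b) - outer_angle m k) \<noteq> 0"
    using sin_unit_between[OF assms(1), of "int a + int b - 2 * int k"]
    by (auto simp: outer_angle_def algebra_simps)
  ultimately show ?thesis by (simp add: crs_outer_inner_diff)
qed

text \<open>
  Up to multiples of \<open>2 m\<close>, \<open>b = s - a\<close>, so the two cross products have the factors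
  \<open>sin A sin (B + \<delta>)\<close> and \<open>sin B sin (A + \<delta>)\<close>, where \<open>A\<close> and \<open>B\<close> are multiples of three units but not
  of \<open>\<pi>\<close>, and \<open>\<delta>\<close> is less than three units.
\<close>

lemma outer_sees_inner_zigzag_monotone:
  assumes m: "m > 0" and j: "j < m" "k = j \<or> k = j + m"
    and ab: "a < 2 * m" "b < 2 * m" "c < 2 * m" "c \<noteq> a" "c \<noteq> b" and z: "zigzag (2 * m) (2 * int j) a b"
  shows "crs (outer m k) (inner m c - inner m a) * crs (outer m k) (inner m c - inner m b) > 0"
proof -
  obtain q e where q: "int a + int b - 2 * int j = 2 * int m * q + e" "e = 0 \<or> e = 1"
    using z unfolding zigzag_def by (metis insertE mult_div_mod_eq of_nat_mult of_nat_numeral singletonD)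
  define \<tau> where "\<tau> = outer_angle m k"
  define s where "s = 2 * int j + e"
  have b: "int b = 2 * int m * q + (s - int a)" using q by (simp add: s_def)
  \<comment> \<open>The sign of the \<open>q\<close> half turns between \<open>3 b\<close> and
    \<open>3 (s - a)\<close>; it ends up squared.\<close>
  define \<sigma> where "\<sigma> = cos (of_int q * pi :: real)"
  have \<sigma>2: "\<sigma> * \<sigma> = 1"
    by (simp add: \<sigma>_def cos_int_times_pi_squared)
  \<comment> \<open>The sign of the half turn that takes the outer point \<open>j + m\<close> near
    the outer point \<open>j\<close>.\<close>
  define \<rho> :: real where "\<rho> = (if k = j then 1 else -1)"
  \<comment> \<open>Offset of the chord direction \<open>3 s\<close> from the line of sight: one of
    -1, -2, 2, 1.\<close>
  define \<delta> where "\<delta> = 3 * s - (6 * int j + (if k = j then 1 else 2))"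
  have \<delta>: "\<bar>\<delta>\<bar> < 3" using q by (auto simp: \<delta>_def s_def)
  have \<tau>: "\<tau> = 3 * s - \<delta> + (if k = j then 0 else 6 * int m)" using j by (auto simp: \<tau>_def outer_angle_def \<delta>_def)
  have sh: "sin_unit m (t - \<tau>) = \<rho> * sin_unit m (t - 3 * s + \<delta>)" for t
    using sin_unit_shift1[OF m, of "t - \<tau>"] by (auto simp: \<rho>_def \<tau> algebra_simps)
  define A where "A = int c - int a"
  define B where "B = int c + int a - s"
  have 1: "sin_unit m (3 * (int c + int a) - \<tau>) = \<rho> * sin_unit m (3 * B + \<delta>)"
    unfolding sh by (simp add: B_def algebra_simps)
  have 2: "sin_unit m (3 * (int c - int b)) = \<sigma> * sin_unit m (3 * B)"
    using sin_unit_shift[OF m, of "- q" "3 * B"] by (simp add: b B_def \<sigma>_def algebra_simps)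
  have 3: "sin_unit m (3 * (int c + int b) - \<tau>) = \<rho> * \<sigma> * sin_unit m (3 * A + \<delta>)"
    unfolding sh using sin_unit_shift[OF m, of q "3 * A + \<delta>"] by (simp add: b A_def \<sigma>_def algebra_simps)
  have \<rho>2: "\<rho> * \<rho> = 1" by (simp add: \<rho>_def)
  have "crs (outer m k) (inner m c - inner m a) * crs (outer m k) (inner m c - inner m b)
     = 4 * (\<rho> * \<rho>) * (\<sigma> * \<sigma>) * (sin_unit m (3 * A) * sin_unit m (3 * A + \<delta>)) * (sin_unit m (3 * B) * sin_unit m (3 * B + \<delta>))"
    unfolding crs_outer_inner_diff 1[unfolded \<tau>_def] 2 3[unfolded \<tau>_def] A_def by simp
  also have "\<dots> > 0"
  proof -
    have "\<not> 2 * int m dvd A" using not_dvd_diff[of c "2 * m" a] ab by (simp add: A_def)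
    moreover have "\<not> 2 * int m dvd B"
    proof
      assume "2 * int m dvd B"
      then have "2 * int m dvd B - 2 * int m * q" by simp
      then have "2 * int m dvd int c - int b" by (simp add: b B_def algebra_simps)
      then show False using not_dvd_diff[of c "2 * m" b] ab by simp
    qed
    ultimately show ?thesis using sin_unit_perturb[OF m _ \<delta>] \<rho>2 \<sigma>2 by simp
  qed
  finally show ?thesis .
qed

text \<open>No chord direction, being a multiple of three, lies between \<open>6 j + 1\<close> and
  \<open>6 j + 2\<close>, so the two nearly opposite views of a chord are mirrored.\<close>

lemma opposite_outer_see_inner_reversed:
  assumes m: "m > 0" "j < m" and ab: "a < 2 * m" "b < 2 * m" "a \<noteq> b"
  shows "crs (outer m j) (inner m a - inner m b) * crs (outer m (j + m)) (inner m b - inner m a) > 0"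
proof -
  define c where "c = int a + int b - 2 * int j"
  have "sin_unit m (3 * (int a + int b) - outer_angle m j) = sin_unit m (3 * c - 1)"
    using m by (simp add: outer_angle_def c_def algebra_simps)
  moreover have "sin_unit m (3 * (int b + int a) - outer_angle m (j + m)) = - sin_unit m (3 * c - 2)"
    using m sin_unit_shift1[of m "3 * (int b + int a) - outer_angle m (j + m)"]
    by (simp add: outer_angle_def c_def algebra_simps)
  moreover have "sin_unit m (3 * (int b - int a)) = - sin_unit m (3 * (int a - int b))"
    by (simp add: sin_unit_def algebra_simps flip: sin_minus)
  ultimately have "crs (outer m j) (inner m a - inner m b) * crs (outer m (j + m)) (inner m b - inner m a)
    = 4 * (sin_unit m (3 * (int a - int b)))\<^sup>2 * (sin_unit m (3 * c - 1) * sin_unit m (3 * c - 2))"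
    unfolding crs_outer_inner_diff by (simp add: power2_eq_square)
  moreover have "sin_unit m (3 * (int a - int b)) \<noteq> 0"
    using sin_unit_perturb[OF m(1), of "int a - int b" 0] not_dvd_diff[of a "2 * m" b] ab by auto
  ultimately show ?thesis using sin_unit_between[OF m(1), of c] by simp
qed

section \<open>Shrinking the inner ring\<close>

lemma eventually_sgn_perturb:
  fixes c d :: real assumes "c \<noteq> 0"
  shows "eventually (\<lambda>r. sgn (c + r * d) = sgn c) (at_right 0)"
proof -
  have lim: "((\<lambda>r. c + r * d) \<longlongrightarrow> c + 0 * d) (at_right 0)" by (intro tendsto_intros)
  show ?thesis
  proof (cases "c > 0")
    case True
    then have "eventually (\<lambda>r. c + r * d > 0) (at_right 0)" using order_tendstoD(1)[OF lim, of 0] by simp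
    then show ?thesis using True by (auto elim: eventually_mono)
  next
    case False
    then have "eventually (\<lambda>r. c + r * d < 0) (at_right 0)" using order_tendstoD(2)[OF lim, of 0] assms by simp
    then show ?thesis using False assms by (auto elim!: eventually_mono)
  qed
qed

text \<open>The inner ring of radius \<open>r\<close> has the same orientations as in the limit \<open>r \<rightarrow> 0\<close>.\<close>

definition small_radius :: "nat \<Rightarrow> real \<Rightarrow> bool" where
  "small_radius m r \<longleftrightarrow> r > 0 \<and>
     (\<forall>k<2*m. \<forall>a<2*m. \<forall>b<2*m. a \<noteq> b \<longrightarrow>
        sgn (orient (outer m k) (r *\<^sub>R inner m a) (r *\<^sub>R inner m b)) = sgn (crs (outer m k) (inner m a - inner m b))) \<and>
     (\<forall>k<2*m. \<forall>l<2*m. \<forall>a<2*m. k \<noteq> l \<longrightarrow>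
        sgn (orient (outer m k) (outer m l) (r *\<^sub>R inner m a)) = sgn (crs (outer m k) (outer m l)))"

lemma crs_commute: "crs q p = - crs p q"
  by (simp add: crs_def)

lemma crs_outer_outer_nonzero:
  assumes "k \<noteq> l" "k < 2 * m" "l < 2 * m"
  shows "crs (outer m k) (outer m l) \<noteq> 0"
  using sgn_crs_outer_outer[of k l m] sgn_crs_outer_outer[of l k m] assms crs_commute[of "outer m k" "outer m l"]
  by (cases k l rule: linorder_cases) (auto split: if_splits)

text \<open>Finitely many signs are involved, each fixed by a nonzero leading term once
  \<open>r\<close> is small.\<close>

lemma ex_small_radius:
  assumes m: "m > 0" shows "\<exists>r. small_radius m r"
proof -
  have 1: "eventually (\<lambda>r. sgn (orient (outer m k) (r *\<^sub>R inner m a) (r *\<^sub>R inner m b))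
      = sgn (crs (outer m k) (inner m a - inner m b))) (at_right 0)"
    if "k < 2 * m" "a < 2 * m" "b < 2 * m" "a \<noteq> b" for k a b
  proof -
    \<comment> \<open>The leading term is linear in \<open>r\<close>; the positive factor
      \<open>r\<close> drops out of the sign.\<close>
    have eq: "orient (outer m k) (r *\<^sub>R inner m a) (r *\<^sub>R inner m b)
       = r * (crs (outer m k) (inner m a - inner m b) + r * crs (inner m a) (inner m b))" for r
      by (simp add: orient_def crs_def algebra_simps)
    show ?thesis
      using eventually_sgn_perturb[OF crs_outer_inner_diff_nonzero[OF m that], of "crs (inner m a) (inner m b)"]
        eventually_at_right_less[of "0::real"]
      by eventually_elim (simp add: eq sgn_mult)
  qed
  have 2: "eventually (\<lambda>r. sgn (orient (outer m k) (outer m l) (r *\<^sub>R inner m a))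
      = sgn (crs (outer m k) (outer m l))) (at_right 0)"
    if "k < 2 * m" "l < 2 * m" "k \<noteq> l" for k l a
  proof -
    have eq: "orient (outer m k) (outer m l) (r *\<^sub>R inner m a)
       = crs (outer m k) (outer m l) + r * crs (inner m a) (outer m k - outer m l)" for r
      by (simp add: orient_def crs_def algebra_simps)
    show ?thesis unfolding eq
      using that by (intro eventually_sgn_perturb crs_outer_outer_nonzero)
  qed
  have "eventually (\<lambda>r. \<forall>k\<in>{..<2*m}. \<forall>a\<in>{..<2*m}. \<forall>b\<in>{..<2*m}. a \<noteq> b \<longrightarrow>
        sgn (orient (outer m k) (r *\<^sub>R inner m a) (r *\<^sub>R inner m b)) = sgn (crs (outer m k) (inner m a - inner m b)))
      (at_right 0)"
    using 1 by (intro eventually_ball_finite ballI) (auto intro: eventually_mono)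
  moreover have "eventually (\<lambda>r. \<forall>k\<in>{..<2*m}. \<forall>l\<in>{..<2*m}. \<forall>a\<in>{..<2*m}. k \<noteq> l \<longrightarrow>
        sgn (orient (outer m k) (outer m l) (r *\<^sub>R inner m a)) = sgn (crs (outer m k) (outer m l)))
      (at_right 0)"
    using 2 by (intro eventually_ball_finite ballI) (auto intro: eventually_mono)
  ultimately have "eventually (small_radius m) (at_right 0)"
    using eventually_at_right_less[of "0::real"]
    by eventually_elim (auto simp: small_radius_def)
  then show ?thesis using eventually_happens'[OF trivial_limit_at_right_real] by blast
qed

section \<open>The layers\<close>

definition ring_point :: "nat \<Rightarrow> real \<Rightarrow> nat + nat \<Rightarrow> real \<times> real" where
  "ring_point m r x = (case x of Inl k \<Rightarrow> outer m k | Inr a \<Rightarrow> r *\<^sub>R inner m a)"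

lemma ring_point_simps [simp]: "ring_point m r (Inl k) = outer m k" "ring_point m r (Inr a) = r *\<^sub>R inner m a"
  by (simp_all add: ring_point_def)

definition ring_vertices :: "nat \<Rightarrow> (nat + nat) set" where
  "ring_vertices m = {..<2*m} <+> {..<2*m}"

text \<open>\<open>2 j + m\<close> is the index sum of \<open>j\<close> and \<open>j + m\<close>,
  which puts that edge into the outer zigzag. The inner offset \<open>2 j\<close> gives chord
  directions \<open>6 j\<close> and \<open>6 j + 3\<close>, around both lines of sight.\<close>

definition layer :: "nat \<Rightarrow> nat \<Rightarrow> nat + nat \<Rightarrow> nat + nat \<Rightarrow> bool" where
  "layer m j x y = (case (x, y) of
     (Inl k, Inl l) \<Rightarrow> zigzag (2 * m) (2 * int j + int m) k l
   | (Inr a, Inr b) \<Rightarrow> zigzag (2 * m) (2 * int j) a b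
   | (Inl k, Inr a) \<Rightarrow> k = j \<or> k = j + m
   | (Inr a, Inl k) \<Rightarrow> k = j \<or> k = j + m)"

lemma layer_simps [simp]:
  "layer m j (Inl k) (Inl l) \<longleftrightarrow> zigzag (2 * m) (2 * int j + int m) k l"
  "layer m j (Inr a) (Inr b) \<longleftrightarrow> zigzag (2 * m) (2 * int j) a b"
  "layer m j (Inl k) (Inr a) \<longleftrightarrow> k = j \<or> k = j + m"
  "layer m j (Inr a) (Inl k) \<longleftrightarrow> k = j \<or> k = j + m"
  by (simp_all add: layer_def)

lemma layer_sym: "layer m j x y \<longleftrightarrow> layer m j y x"
  by (cases x; cases y) (auto simp: zigzag_sym)

section \<open>Every edge belongs to a layer\<close>

lemma ex_zigzag:
  assumes "m > 0" shows "\<exists>j<m. zigzag (2 * m) (2 * int j + s) k l"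
proof -
  define t where "t = (int k + int l - s) mod (2 * int m)"
  \<comment> \<open>A zigzag covers two consecutive residues, so half of \<open>t\<close> selects it
    and the parity of \<open>t\<close> is left over.\<close>
  define j where "j = nat (t div 2)"
  have t: "0 \<le> t" "t < 2 * int m" using assms by (auto simp: t_def)
  then have j: "int j = t div 2" by (simp add: j_def)
  have "(int k + int l - (2 * int j + s)) mod (2 * int m) = ((int k + int l - s) - 2 * int j) mod (2 * int m)"
    by (simp add: algebra_simps)
  also have "\<dots> = (t - 2 * int j) mod (2 * int m)" by (simp add: t_def mod_diff_left_eq)
  also have "t - 2 * int j = t mod 2" by (simp add: j minus_mult_div_eq_mod)
  also have "t mod 2 mod (2 * int m) = t mod 2" using assms by (intro mod_pos_pos_trivial) auto
  finally have "zigzag (2 * m) (2 * int j + s) k l" by (auto simp: zigzag_def)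
  moreover have "j < m" using t j by linarith
  ultimately show ?thesis by blast
qed

lemma ex_layer:
  assumes m: "m > 0" and "x \<in> ring_vertices m" "y \<in> ring_vertices m"
  shows "\<exists>j<m. layer m j x y"
proof -
  have mixed: "\<exists>j<m. k = j \<or> k = j + m" if "k < 2 * m" for k
    using that m by (intro exI[of _ "if k < m then k else k - m"]) auto
  show ?thesis
    using assms ex_zigzag[OF m, of "int m"] ex_zigzag[OF m, of 0] mixed
    by (cases x; cases y) (auto simp: ring_vertices_def)
qed

lemma outer_angle_strict_mono:
  assumes "i < j" "j < 2 * m"
  shows "of_int (outer_angle m i) * (pi / (6 * real m)) < of_int (outer_angle m j) * (pi / (6 * real m)) \<and>
    of_int (outer_angle m j) * (pi / (6 * real m)) - of_int (outer_angle m i) * (pi / (6 * real m)) < 2 * pi"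
proof -
  have "outer_angle m i < outer_angle m j" "outer_angle m j - outer_angle m i < 12 * int m"
    using assms by (auto simp: outer_angle_def)
  then have a: "real_of_int (outer_angle m i) < of_int (outer_angle m j)"
    "real_of_int (outer_angle m j) - of_int (outer_angle m i) < 12 * real m" by linarith+
  have h: "pi / (6 * real m) > 0" using assms by simp
  have "(real_of_int (outer_angle m j) - of_int (outer_angle m i)) * (pi / (6 * real m))
      < 12 * real m * (pi / (6 * real m))"
    using a(2) h by (rule mult_strict_right_mono)
  also have "\<dots> = 2 * pi" using assms by (simp add: field_simps)
  finally show ?thesis using mult_strict_right_mono[OF a(1) h] unfolding left_diff_distrib by (intro conjI)
qed

lemma inner_angle_strict_mono:
  assumes "i < j" "j < 2 * m"
  shows "6 * real i * (pi / (6 * real m)) - pi / 2 < 6 * real j * (pi / (6 * real m)) - pi / 2 \<and>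
    (6 * real j * (pi / (6 * real m)) - pi / 2) - (6 * real i * (pi / (6 * real m)) - pi / 2) < 2 * pi"
proof -
  have "real j - real i < 2 * real m" using assms by linarith
  then have "pi * (real j - real i) < pi * (2 * real m)" by (intro mult_strict_left_mono) auto
  then show ?thesis using assms by (simp add: field_simps)
qed

lemma orient_circle_nonzero:
  fixes f :: "nat \<Rightarrow> real"
  assumes f: "\<And>i j. i < j \<Longrightarrow> j < N \<Longrightarrow> f i < f j \<and> f j - f i < 2 * pi"
    and "a < N" "b < N" "c < N" "a \<noteq> b" "b \<noteq> c" "a \<noteq> c"
  shows "orient (on_circle (f a)) (on_circle (f b)) (on_circle (f c)) \<noteq> 0"
proof -
  have bnd: "\<bar>f j - f i\<bar> < 2 * pi \<and> f i \<noteq> f j" if "i < N" "j < N" "i \<noteq> j" for i j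
    using f[of i j] f[of j i] that by (cases i j rule: linorder_cases) auto
  have "sgn (orient (on_circle (f a)) (on_circle (f b)) (on_circle (f c))) \<noteq> 0"
    using bnd[of a b] bnd[of b c] bnd[of a c] assms(2-) by (simp add: sgn_orient_on_circle sgn_zero_iff)
  then show ?thesis by auto
qed

lemma orient_scaleR: "orient (r *\<^sub>R a) (r *\<^sub>R b) (r *\<^sub>R c) = r\<^sup>2 * orient a b c"
  by (simp add: orient_def crs_def power2_eq_square algebra_simps)

section \<open>Separation of the edges of one layer\<close>

context
  fixes m :: nat and r :: real
  assumes m: "m > 0" and r: "small_radius m r"
begin

lemma radius_pos: "r > 0"
  using r by (simp add: small_radius_def)

lemma sgn_orient_OII:
  "\<lbrakk>k < 2 * m; a < 2 * m; b < 2 * m; a \<noteq> b\<rbrakk> \<Longrightarrow>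
    sgn (orient (outer m k) (r *\<^sub>R inner m a) (r *\<^sub>R inner m b)) = sgn (crs (outer m k) (inner m a - inner m b))"
  using r by (simp add: small_radius_def)

lemma sgn_orient_OOI:
  "\<lbrakk>k < 2 * m; l < 2 * m; a < 2 * m; k \<noteq> l\<rbrakk> \<Longrightarrow>
    sgn (orient (outer m k) (outer m l) (r *\<^sub>R inner m a)) = sgn (crs (outer m k) (outer m l))"
  using r by (simp add: small_radius_def)

lemma general_position_ring: "general_position (ring_vertices m) (ring_point m r)"
proof -
  have OOO: "orient (outer m k) (outer m l) (outer m i) \<noteq> 0"
    if "k < 2 * m" "l < 2 * m" "i < 2 * m" "k \<noteq> l" "l \<noteq> i" "k \<noteq> i" for k l i
    unfolding outer_def by (rule orient_circle_nonzero[where f = "\<lambda>k. of_int (outer_angle m k) * (pi / (6 * real m))", OF outer_angle_strict_mono that])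
  have III: "orient (r *\<^sub>R inner m a) (r *\<^sub>R inner m b) (r *\<^sub>R inner m c) \<noteq> 0"
    if "a < 2 * m" "b < 2 * m" "c < 2 * m" "a \<noteq> b" "b \<noteq> c" "a \<noteq> c" for a b c
  proof -
    have "orient (inner m a) (inner m b) (inner m c) \<noteq> 0"
      unfolding inner_def by (rule orient_circle_nonzero[where f = "\<lambda>k. 6 * real k * (pi / (6 * real m)) - pi / 2", OF inner_angle_strict_mono that])
    then show ?thesis using radius_pos by (simp add: orient_scaleR)
  qed
  have OII: "orient (outer m k) (r *\<^sub>R inner m a) (r *\<^sub>R inner m b) \<noteq> 0"
    if "k < 2 * m" "a < 2 * m" "b < 2 * m" "a \<noteq> b" for k a b
    using sgn_orient_OII[OF that] crs_outer_inner_diff_nonzero[OF m that] by (metis sgn_eq_0_iff)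
  have OOI: "orient (outer m k) (outer m l) (r *\<^sub>R inner m a) \<noteq> 0"
    if "k < 2 * m" "l < 2 * m" "a < 2 * m" "k \<noteq> l" for k l a
    using sgn_orient_OOI[OF that] crs_outer_outer_nonzero[of k l m] that by (metis sgn_eq_0_iff)
  have "orient (ring_point m r x) (ring_point m r y) (ring_point m r z) \<noteq> 0"
    if "x \<in> ring_vertices m" "y \<in> ring_vertices m" "z \<in> ring_vertices m" "x \<noteq> y" "y \<noteq> z" "x \<noteq> z" for x y z
  proof -
    \<comment> \<open>Cyclic rotation brings outer vertices to the front and leaves one case for
      each number of inner vertices.\<close>
    note rot = orient_rotate[of "ring_point m r x" "ring_point m r y" "ring_point m r z"]
      orient_rotate[of "ring_point m r y" "ring_point m r z" "ring_point m r x"]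
    show ?thesis
    proof (cases x; cases y; cases z)
    fix a k b assume "x = Inr a" "y = Inl k" "z = Inr b"
    then show ?thesis using that OII[of k b a] rot
      by (auto simp: ring_vertices_def)
  next
    fix a k b assume "x = Inr a" "y = Inr b" "z = Inl k"
    then show ?thesis using that OII[of k a b] rot
      by (auto simp: ring_vertices_def)
  next
    fix a k l assume "x = Inr a" "y = Inl k" "z = Inl l"
    then show ?thesis using that OOI[of k l a] rot
      by (auto simp: ring_vertices_def)
  next
    fix a k l assume "x = Inl k" "y = Inr a" "z = Inl l"
    then show ?thesis using that OOI[of l k a] rot
      by (auto simp: ring_vertices_def)
    qed (use that OOO III OII OOI in \<open>auto simp: ring_vertices_def\<close>)
  qed
  then show ?thesis unfolding general_position_def by blast
qed

text \<open>Coinciding points would be collinear with any third vertex; one exists because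
  \<open>4 m > 2\<close>.\<close>

lemma inj_on_ring_point: "inj_on (ring_point m r) (ring_vertices m)"
proof (rule inj_onI, rule ccontr)
  fix x y assume xy: "x \<in> ring_vertices m" "y \<in> ring_vertices m" "ring_point m r x = ring_point m r y" "x \<noteq> y"
  have "card {x, y} < card (ring_vertices m)"
    using xy(4) m by (simp add: ring_vertices_def card_Plus)
  then have "\<not> ring_vertices m \<subseteq> {x, y}" using card_mono[of "{x, y}" "ring_vertices m"] by auto
  then obtain z where "z \<in> ring_vertices m" "z \<noteq> x" "z \<noteq> y" by auto
  then have "orient (ring_point m r x) (ring_point m r y) (ring_point m r z) \<noteq> 0"
    using general_position_ring xy unfolding general_position_def by metis
  then show False using xy(3) by simp
qed

lemma separated_OO_OO:
  assumes "distinct [k, l, k', l']" "k < 2 * m" "l < 2 * m" "k' < 2 * m" "l' < 2 * m"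
    and "zigzag (2 * m) s k l" "zigzag (2 * m) s k' l'"
  shows "separated (ring_point m r) (Inl k) (Inl l) (Inl k') (Inl l')"
proof -
  \<comment> \<open>Ascending ends suffice, since \<open>separated\<close> does not depend on the
    order of ends.\<close>
  have *: "separated (ring_point m r) (Inl k) (Inl l) (Inl k') (Inl l')"
    if "distinct [k, l, k', l']" "k < l" "k' < l'" "l < 2 * m" "l' < 2 * m"
      "zigzag (2 * m) s k l" "zigzag (2 * m) s k' l'" for k l k' l'
    unfolding separated_def ring_point_simps outer_def
    using orient_on_circle_pos_if_not_interleaved[where f = "\<lambda>k. of_int (outer_angle m k) * (pi / (6 * real m))",
        OF outer_angle_strict_mono that(2-5,1) zigzag_not_interleaved[OF that(6,7,4,5)]] by blast
  show ?thesis
  proof (cases "k < l")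
    case True
    then show ?thesis
      using *[of k l k' l'] *[of k l l' k'] assms zigzag_sym[of _ _ l' k']
        separated_swap_right[of "ring_point m r" "Inl k" "Inl l" "Inl l'" "Inl k'"]
      by (cases "k' < l'") auto
  next
    case False
    then have "separated (ring_point m r) (Inl l) (Inl k) (Inl k') (Inl l')"
      using *[of l k k' l'] *[of l k l' k'] assms zigzag_sym[of _ _ l' k'] zigzag_sym[of _ _ l k]
        separated_swap_right[of "ring_point m r" "Inl l" "Inl k" "Inl l'" "Inl k'"]
      by (cases "k' < l'") auto
    then show ?thesis by (simp only: separated_swap_left)
  qed
qed

lemma separated_II_II:
  assumes "distinct [a, b, a', b']" "a < 2 * m" "b < 2 * m" "a' < 2 * m" "b' < 2 * m"
    and "zigzag (2 * m) s a b" "zigzag (2 * m) s a' b'"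
  shows "separated (ring_point m r) (Inr a) (Inr b) (Inr a') (Inr b')"
proof -
  have *: "separated (ring_point m r) (Inr k) (Inr l) (Inr k') (Inr l')"
    if "distinct [k, l, k', l']" "k < l" "k' < l'" "l < 2 * m" "l' < 2 * m"
      "zigzag (2 * m) s k l" "zigzag (2 * m) s k' l'" for k l k' l'
  proof -
    have "orient (inner m k) (inner m l) (inner m k') * orient (inner m k) (inner m l) (inner m l') > 0"
      unfolding inner_def
      by (rule orient_on_circle_pos_if_not_interleaved[where f = "\<lambda>k. 6 * real k * (pi / (6 * real m)) - pi / 2",
        OF inner_angle_strict_mono that(2-5,1) zigzag_not_interleaved[OF that(6,7,4,5)]])
    then have "r\<^sup>2 * r\<^sup>2 * (orient (inner m k) (inner m l) (inner m k') * orient (inner m k) (inner m l) (inner m l')) > 0"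
      using radius_pos by simp
    then show ?thesis unfolding separated_def ring_point_simps orient_scaleR by (simp add: mult_ac)
  qed
  show ?thesis
  proof (cases "a < b")
    case True
    then show ?thesis
      using *[of a b a' b'] *[of a b b' a'] assms zigzag_sym[of _ _ b' a']
        separated_swap_right[of "ring_point m r" "Inr a" "Inr b" "Inr b'" "Inr a'"]
      by (cases "a' < b'") auto
  next
    case False
    then have "separated (ring_point m r) (Inr b) (Inr a) (Inr a') (Inr b')"
      using *[of b a a' b'] *[of b a b' a'] assms zigzag_sym[of _ _ b' a'] zigzag_sym[of _ _ b a]
        separated_swap_right[of "ring_point m r" "Inr b" "Inr a" "Inr b'" "Inr a'"]
      by (cases "a' < b'") auto
    then show ?thesis by (simp only: separated_swap_left)
  qed
qed

text \<open>The small radius keeps the whole inner ring on the centre's side of every outer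
  chord.\<close>

lemma separated_OO_II:
  assumes "k \<noteq> l" "k < 2 * m" "l < 2 * m" "a < 2 * m" "b < 2 * m"
  shows "separated (ring_point m r) (Inl k) (Inl l) (Inr a) (Inr b)"
proof -
  have "crs (outer m k) (outer m l) * crs (outer m k) (outer m l) > 0"
    using crs_outer_outer_nonzero[of k l m] assms by (simp flip: power2_eq_square)
  then show ?thesis unfolding separated_def ring_point_simps
    using mult_pos_cong_sgn[OF sgn_orient_OOI sgn_orient_OOI, of k l a k l b] assms by blast
qed

lemma zigzag_main_diagonal: "zigzag (2 * m) (2 * int j + int m) j (j + m)"
  by (simp add: zigzag_def)

text \<open>The chord \<open>k l\<close> does not cross the zigzag edge from \<open>j\<close> to
  \<open>j + m\<close>, so \<open>i\<close> is on the centre's side of it, together with the inner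
  ring.\<close>

lemma separated_OO_OI:
  assumes j: "j < m" "i = j \<or> i = j + m" and kl: "k < 2 * m" "l < 2 * m" "k \<noteq> l" "i \<noteq> k" "i \<noteq> l" and a: "a < 2 * m"
    and z: "zigzag (2 * m) (2 * int j + int m) k l"
  shows "separated (ring_point m r) (Inl k) (Inl l) (Inl i) (Inr a)"
proof -
  have *: "separated (ring_point m r) (Inl k) (Inl l) (Inl i) (Inr a)"
    if kl: "k < l" "l < 2 * m" "i \<noteq> k" "i \<noteq> l" and z: "zigzag (2 * m) (2 * int j + int m) k l" for k l
  proof -
    have ni: "\<not> interleaved k l j (j + m)"
      using zigzag_not_interleaved[OF z zigzag_main_diagonal kl(2)] j by simp
    have f: "\<bar>of_int (outer_angle m i) * (pi / (6 * real m)) - of_int (outer_angle m k) * (pi / (6 * real m))\<bar> < 2 * pi"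
      "\<bar>of_int (outer_angle m i) * (pi / (6 * real m)) - of_int (outer_angle m l) * (pi / (6 * real m))\<bar> < 2 * pi"
      "\<bar>of_int (outer_angle m l) * (pi / (6 * real m)) - of_int (outer_angle m k) * (pi / (6 * real m))\<bar> < 2 * pi"
      using outer_angle_strict_mono[of i k m] outer_angle_strict_mono[of k i m]
        outer_angle_strict_mono[of i l m] outer_angle_strict_mono[of l i m] outer_angle_strict_mono[of k l m]
        j kl by (cases i k rule: linorder_cases; cases i l rule: linorder_cases; force)+
    have sg: "sgn (of_int (outer_angle m y) * (pi / (6 * real m)) - of_int (outer_angle m x) * (pi / (6 * real m)))
        = (if x < y then 1 else -1)" if "x \<noteq> y" "x < 2 * m" "y < 2 * m" for x y
      using outer_angle_strict_mono[of x y m] outer_angle_strict_mono[of y x m] that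
      by (cases x y rule: linorder_cases) auto
    have "sgn (orient (outer m k) (outer m l) (outer m i)) = (if k < i \<and> i < l then -1 else 1)"
      unfolding outer_def sgn_orient_on_circle[OF f(3,2,1)] using sg[of k l] sg[of l i] sg[of k i] j kl by auto
    \<comment> \<open>Without a crossing of the diagonal, \<open>i\<close> lies between
      \<open>k\<close> and \<open>l\<close> exactly when \<open>l - k\<close> is at least
      \<open>m\<close>.\<close>
    also have "\<dots> = (if l - k < m then 1 else -1)"
      using ni j kl unfolding interleaved_def by auto
    also have "\<dots> = sgn (crs (outer m k) (outer m l))" using kl by (simp add: sgn_crs_outer_outer)
    finally have "sgn (orient (outer m k) (outer m l) (outer m i)) = sgn (crs (outer m k) (outer m l))" .
    moreover have "sgn (orient (outer m k) (outer m l) (r *\<^sub>R inner m a)) = sgn (crs (outer m k) (outer m l))"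
      using kl a by (intro sgn_orient_OOI) auto
    moreover have "crs (outer m k) (outer m l) * crs (outer m k) (outer m l) > 0"
      using crs_outer_outer_nonzero[of k l m] kl by (simp flip: power2_eq_square)
    ultimately show ?thesis unfolding separated_def ring_point_simps using mult_pos_cong_sgn by blast
  qed
  show ?thesis using *[of k l] *[of l k] kl z zigzag_sym[of _ _ k l] separated_swap_left[of "ring_point m r" "Inl k" "Inl l"]
    by (cases k l rule: linorder_cases) auto
qed

text \<open>The separating line runs through \<open>i\<close> and \<open>c\<close>: seen from
  \<open>i\<close>, the inner zigzag is monotone, so \<open>c\<close> is not between
  \<open>a\<close> and \<open>b\<close>.\<close>

lemma separated_II_OI:
  assumes j: "j < m" "i = j \<or> i = j + m" and ab: "a < 2 * m" "b < 2 * m" "c < 2 * m" "c \<noteq> a" "c \<noteq> b"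
    and z: "zigzag (2 * m) (2 * int j) a b"
  shows "separated (ring_point m r) (Inr a) (Inr b) (Inl i) (Inr c)"
proof -
  have "i < 2 * m" using j by auto
  then show ?thesis unfolding separated_def ring_point_simps
    using mult_pos_cong_sgn[OF sgn_orient_OII sgn_orient_OII, of i c a i c b]
      outer_sees_inner_zigzag_monotone[OF m j ab z] ab by blast
qed

lemma separated_OI_OI:
  assumes j: "j < m" and i: "i = j \<or> i = j + m" "i' = j \<or> i' = j + m" "i \<noteq> i'"
    and ab: "a < 2 * m" "b < 2 * m" "a \<noteq> b"
  shows "separated (ring_point m r) (Inl i) (Inr a) (Inl i') (Inr b)"
proof -
  have *: "separated (ring_point m r) (Inl j) (Inr a) (Inl (j + m)) (Inr b)"
    if ab: "a < 2 * m" "b < 2 * m" "a \<noteq> b" for a b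
  proof -
    let ?A = "outer m j" and ?B = "outer m (j + m)" and ?a = "r *\<^sub>R inner m a" and ?b = "r *\<^sub>R inner m b"
    have "orient ?A ?a ?b * orient ?B ?b ?a > 0"
      using mult_pos_cong_sgn[OF sgn_orient_OII sgn_orient_OII, of j a b "j + m" b a] j ab
        opposite_outer_see_inner_reversed[OF m j ab] by auto
    moreover have "orient ?A ?a ?B * orient ?B ?b ?A < 0"
    proof -
      have "crs ?A ?B * crs ?A ?B > 0"
        using crs_outer_outer_nonzero[of j "j + m" m] j m by (simp flip: power2_eq_square)
      then have "orient ?A ?B ?a * orient ?A ?B ?b > 0"
        using mult_pos_cong_sgn[OF sgn_orient_OOI sgn_orient_OOI, of j "j + m" a j "j + m" b] j m ab by auto
      then show ?thesis using orient_swap23[of ?A ?B ?a] orient_rotate[of ?B ?b ?A] by simp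
    qed
    \<comment> \<open>\<open>orient ?A ?a ?b\<close> and \<open>orient ?B ?b ?a\<close> agree in
      sign while \<open>orient ?A ?a ?B\<close> and \<open>orient ?B ?b ?A\<close> differ, so
      exactly one of the two products in \<open>separated\<close> is positive.\<close>
    ultimately show ?thesis unfolding separated_def ring_point_simps
      by (auto simp: zero_less_mult_iff mult_less_0_iff)
  qed
  show ?thesis using *[of a b] *[of b a] i ab by (auto simp: separated_swap_edges)
qed

lemma separated_layer:
  assumes j: "j < m" and xy: "layer m j x y" "layer m j z w" "distinct [x, y, z, w]"
    and V: "x \<in> ring_vertices m" "y \<in> ring_vertices m" "z \<in> ring_vertices m" "w \<in> ring_vertices m"
  shows "separated (ring_point m r) x y z w"
proof -
  note sw = separated_swap_edges[of "ring_point m r"]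
  note sl = separated_swap_left[of "ring_point m r"]
  note sr = separated_swap_right[of "ring_point m r"]
  \<comment> \<open>Covers all pairs with an edge between the rings once swaps have brought that
    edge to the second place, outer end first.\<close>
  have mixed: "separated (ring_point m r) x y z w"
    if "layer m j x y" "layer m j z w" "distinct [x, y, z, w]" "x \<in> ring_vertices m" "y \<in> ring_vertices m"
      "z \<in> ring_vertices m" "w \<in> ring_vertices m" "z = Inl i" "w = Inr c" for x y z w i c
    using that separated_OO_OI[OF j] separated_II_OI[OF j] separated_OI_OI[OF j]
    by (cases x; cases y) (auto simp: ring_vertices_def sl[of "Inr _" "Inl _"])
  consider k l k' l' where "x = Inl k" "y = Inl l" "z = Inl k'" "w = Inl l'"
    | k l k' l' where "x = Inr k" "y = Inr l" "z = Inr k'" "w = Inr l'"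
    | k l a b where "x = Inl k" "y = Inl l" "z = Inr a" "w = Inr b"
    | k l a b where "x = Inr a" "y = Inr b" "z = Inl k" "w = Inl l"
    | i c where "z = Inl i" "w = Inr c" | i c where "z = Inr c" "w = Inl i"
    | i c where "x = Inl i" "y = Inr c" | i c where "x = Inr c" "y = Inl i"
    by (cases x; cases y; cases z; cases w) auto
  then show ?thesis
  proof cases
    case 1 then show ?thesis using xy V separated_OO_OO by (auto simp: ring_vertices_def)
  next
    case 2 then show ?thesis using xy V separated_II_II by (auto simp: ring_vertices_def)
  next
    case 3 then show ?thesis using xy V separated_OO_II by (auto simp: ring_vertices_def)
  next
    case 4
    then have "separated (ring_point m r) z w x y" using xy V separated_OO_II by (auto simp: ring_vertices_def)
    then show ?thesis by (simp only: sw)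
  next
    case 5 then show ?thesis using mixed[of x y z w] xy V by auto
  next
    case 6
    then have "separated (ring_point m r) x y w z" using mixed[of x y w z] xy V layer_sym by auto
    then show ?thesis by (simp only: sr)
  next
    case 7
    then have "separated (ring_point m r) z w x y" using mixed[of z w x y] xy V by auto
    then show ?thesis by (simp only: sw)
  next
    case 8
    then have "separated (ring_point m r) z w y x" using mixed[of z w y x] xy V layer_sym by auto
    then show ?thesis by (simp only: sw sr)
  qed
qed

end

section \<open>From the rings to complete graphs\<close>

lemma plane_projecting_map_complete:
  fixes V :: "'a set"
  assumes fin: "finite V" and d: "d \<ge> 2" and card: "card V \<le> 4 * card (coord_pairs d)"
  shows "\<exists>\<pi>. plane_projecting_map d V (complete_edges V) \<pi>"
proof -
  define m where "m = card (coord_pairs d)"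
  have "2 * m = d * (d - 1)" by (simp add: m_def card_coord_pairs)
  then have m: "m > 0" using d by (intro gr0I) auto
  obtain r where r: "small_radius m r" using ex_small_radius[OF m] by blast
  have "card (ring_vertices m) = 4 * m" by (simp add: ring_vertices_def card_Plus)
  then obtain g where g: "g ` V \<subseteq> ring_vertices m" "inj_on g V"
    using card_le_inj[OF fin, of "ring_vertices m"] card by (auto simp: m_def ring_vertices_def)
  \<comment> \<open>Asking for both orders of the ends avoids choosing one, and adds nothing because
    \<open>layer\<close> is symmetric.\<close>
  define F where "F j = {e \<in> complete_edges V. \<forall>x\<in>e. \<forall>y\<in>e. x \<noteq> y \<longrightarrow> layer m j (g x) (g y)}" for j
  show ?thesis
  proof (rule plane_projecting_map_if_layers[OF d, where p = "ring_point m r \<circ> g" and F = F])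
    show "inj_on (ring_point m r \<circ> g) V"
      using g inj_on_ring_point[OF m r] by (meson comp_inj_on inj_on_subset)
    have "g a \<noteq> g b" if "a \<in> V" "b \<in> V" "a \<noteq> b" for a b using g that by (auto dest: inj_onD)
    then show "general_position V (ring_point m r \<circ> g)"
      using general_position_ring[OF m r] g unfolding general_position_def by (auto simp: image_subset_iff)
    show "complete_edges V = (\<Union>l<card (coord_pairs d). F l)"
    proof -
      have "\<exists>j<m. e \<in> F j" if e: "e \<in> complete_edges V" for e
      proof -
        obtain a b where ab: "e = {a, b}" "a \<noteq> b" "a \<in> V" "b \<in> V"
          using e by (auto simp: complete_edges_def card_2_iff)
        obtain j where "j < m" "layer m j (g a) (g b)"
          using ex_layer[OF m, of "g a" "g b"] g ab by auto
        then show ?thesis using e ab layer_sym by (auto simp: F_def)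
      qed
      then have "complete_edges V \<subseteq> (\<Union>l<m. F l)" by blast
      moreover have "(\<Union>l<m. F l) \<subseteq> complete_edges V" by (auto simp: F_def)
      ultimately show ?thesis by (simp add: m_def)
    qed
    show "complete_edges V \<subseteq> complete_edges V" ..
    fix l a b c e assume l: "l < card (coord_pairs d)" and F: "{a, b} \<in> F l" "{c, e} \<in> F l"
      and dist: "distinct [a, b, c, e]"
    have V: "a \<in> V" "b \<in> V" "c \<in> V" "e \<in> V" using F by (auto simp: F_def complete_edges_def)
    then have "distinct [g a, g b, g c, g e]" using dist g by (auto dest: inj_onD)
    moreover have "layer m l (g a) (g b)" "layer m l (g c) (g e)" using F dist by (auto simp: F_def)
    ultimately have "separated (ring_point m r) (g a) (g b) (g c) (g e)"
      using V g l by (intro separated_layer[OF m r, of l]) (auto simp: m_def)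
    then show "separated (ring_point m r \<circ> g) a b c e" by (simp add: separated_def)
  qed
qed

theorem theorem1:
  fixes V :: "'a set" and n :: nat
  assumes "finite V" and "card V = n"
  shows "pdim V (complete_edges V) \<le> enat (nat \<lceil>(sqrt (2 * real n + 7) + 1) / 2\<rceil>)"
proof -
  define d where "d = nat \<lceil>(sqrt (2 * real n + 7) + 1) / 2\<rceil>"
  \<comment> \<open>Together with \<open>s\<close> below this yields \<open>d \<ge> 2\<close>, also
    for \<open>n = 0\<close>.\<close>
  have "sqrt (2 * real n + 7) > sqrt 1" by (intro real_sqrt_less_mono) simp
  then have s1: "sqrt (2 * real n + 7) > 1" by simp
  have "(sqrt (2 * real n + 7) + 1) / 2 \<le> real d" unfolding d_def by (rule real_nat_ceiling_ge)
  then have s: "sqrt (2 * real n + 7) \<le> 2 * real d - 1" by simp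
  then have d: "d \<ge> 2" using s1 by linarith
  \<comment> \<open>Squaring yields \<open>n + 3 \<le> 2 d (d - 1)\<close>, with four times the
    number of coordinate pairs on the right.\<close>
  have "(sqrt (2 * real n + 7))\<^sup>2 \<le> (2 * real d - 1)\<^sup>2" using s s1 by (intro power_mono) auto
  then have "2 * real n + 7 \<le> 4 * (real d * (real d - 1)) + 1" by (simp add: power2_eq_square algebra_simps)
  moreover have "real d * (real d - 1) = 2 * real (card (coord_pairs d))"
    using arg_cong[OF card_coord_pairs[of d], of real] d by (simp add: of_nat_diff)
  ultimately have "card V \<le> 4 * card (coord_pairs d)" using assms(2) by linarith
  then have "\<exists>\<pi>. plane_projecting_map d V (complete_edges V) \<pi>"
    using assms(1) d by (intro plane_projecting_map_complete)
  then show ?thesis unfolding d_def[symmetric] pdim_le_enat_iff by blast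
qed

end
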